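(* Let $p>3$ be a prime. Then $$\sum_{k=0}^{[\frac{p-1}6]}\frac{\binom{6k}{3k}}{(-64)^k}\equiv\begin{cases}\frac13\big((-1)^{[\frac{p+1}4]}+2(-1)^{\frac{p-1}2}\big)\pmod p&\text{if }3\mid p-1,\\ \frac13\big((-1)^{[\frac{p+1}4]}-(-1)^{\frac{p-1}2}\big)\pmod p&\text{if }3\mid p-2.\end{cases}$$
   Context: $[x]$ is the greatest integer not exceeding $x$. *)

theory Defs
  imports Complex_Main "HOL-Computational_Algebra.Primes"
begin

text \<open>
  Congruence modulo a prime \<open>p\<close> between rational numbers is congruence in the ring of rational
  \<open>p\<close>-integers, i.e. the rationals whose denominator in lowest terms is not divisible by \<open>p\<close>.
\<close>

definition p_integral :: "nat \<Rightarrow> rat \<Rightarrow> bool" where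
  "p_integral p x \<longleftrightarrow> \<not> int p dvd snd (quotient_of x)"

definition rat_cong :: "rat \<Rightarrow> rat \<Rightarrow> nat \<Rightarrow> bool"
  ("(\<open>indent=1 notation=\<open>mixfix rat_cong\<close>\<close>[_ \<equiv> _] '(pmod _'))") where
  "[a \<equiv> b] (pmod p) \<longleftrightarrow> p_integral p a \<and> p_integral p b \<and> p_integral p ((a - b) / of_nat p)"

end

theory Submission
  imports Defs "HOL-Number_Theory.Cong"
begin

text \<open>
  Put \<open>m = (p - 1) / 2\<close>. For \<open>n \<le> m\<close> one has \<open>binomial(2n, n) \<equiv> (-4)^n binomial(m, n)\<close> modulo \<open>p\<close>,
  so taking \<open>n = 3k\<close> turns the sum into the sum of \<open>binomial(m, j)\<close> over the multiples \<open>j\<close> of 3.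
  By trisection of \<open>(1 + 1)^m\<close> that sum is \<open>(2^m + 2 cos(\<pi> m / 3)) / 3\<close>, and
  \<open>2^m \<equiv> (-1)^[(m + 1) / 2] = (-1)^[(p + 1) / 4]\<close> by Gauss's lemma for 2.
\<close>

section \<open>Rational p-integers\<close>

text \<open>Closure properties are easier to prove with arbitrary fractions than in lowest terms.
  The reduced denominator divides every other denominator of \<open>x\<close>, so it stays prime to
  \<open>p\<close>.\<close>

lemma p_integral_iff:
  assumes "prime p"
  shows "p_integral p x \<longleftrightarrow> (\<exists>a d. \<not> int p dvd d \<and> x = of_int a / of_int d)"
proof
  assume h: "p_integral p x"
  obtain a d where q: "quotient_of x = (a, d)" by fastforce
  then have "x = of_int a / of_int d" by (rule quotient_of_div)
  with h q show "\<exists>a d. \<not> int p dvd d \<and> x = of_int a / of_int d"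
    unfolding p_integral_def by auto
next
  assume "\<exists>a d. \<not> int p dvd d \<and> x = of_int a / of_int d"
  then obtain a d where d: "\<not> int p dvd d" and x: "x = of_int a / of_int d" by blast
  obtain b e where q: "quotient_of x = (b, e)" by fastforce
  have e: "e > 0" and be: "coprime b e" and x': "x = of_int b / of_int e"
    using q quotient_of_denom_pos quotient_of_coprime quotient_of_div by auto
  have "d \<noteq> 0" using d by auto
  then have "of_int (a * e) = (of_int (b * d) :: rat)"
    using x x' e by (simp add: field_simps)
  then have "a * e = b * d" by (simp only: of_int_eq_iff)
  then have "e dvd b * d" by (metis dvd_triv_right)
  with be have "e dvd d" by (simp add: coprime_commute coprime_dvd_mult_right_iff)
  with d q show "p_integral p x" unfolding p_integral_def by (auto dest: dvd_trans)
qed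

lemma p_integral_of_int_divide:
  assumes "prime p" "\<not> int p dvd d"
  shows "p_integral p (of_int a / of_int d)"
  using assms by (auto simp: p_integral_iff)

lemma p_integral_of_int:
  assumes "prime p"
  shows "p_integral p (of_int a)"
  using p_integral_of_int_divide[of p 1 a] assms by (simp add: prime_nat_iff)

lemma p_integral_add:
  assumes "prime p" "p_integral p x" "p_integral p y"
  shows "p_integral p (x + y)"
proof -
  obtain a d b e where d: "\<not> int p dvd d" "x = of_int a / of_int d"
    and e: "\<not> int p dvd e" "y = of_int b / of_int e"
    using assms by (auto simp: p_integral_iff)
  have nz: "d \<noteq> 0" "e \<noteq> 0" using d e by auto
  have "\<not> int p dvd d * e" using d e assms(1) by (simp add: prime_dvd_mult_iff)
  moreover have "x + y = of_int (a * e + b * d) / of_int (d * e)"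
    using nz d e by (simp add: field_simps)
  ultimately show ?thesis using assms(1) p_integral_iff by blast
qed

lemma p_integral_sum:
  assumes "prime p" "\<And>i. i \<in> A \<Longrightarrow> p_integral p (f i)"
  shows "p_integral p (\<Sum>i\<in>A. f i)"
  using assms(2)
proof (induction A rule: infinite_finite_induct)
  case (insert i A)
  then show ?case using assms(1) by (simp add: p_integral_add)
qed (use p_integral_of_int[OF assms(1), of 0] in auto)

text \<open>The bridge from integer congruences to rational ones: clearing the denominator
  \<open>d\<close> is harmless because it is prime to \<open>p\<close>.\<close>

lemma rat_cong_of_int_divide:
  assumes "prime p" "\<not> int p dvd d" "[a = b * d] (mod int p)"
  shows "[of_int a / of_int d \<equiv> of_int b] (pmod p)"
proof -
  obtain t where t: "a - b * d = int p * t"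
    using assms(3) by (auto simp: cong_iff_dvd_diff dvd_def)
  have "d \<noteq> 0" "p \<noteq> 0" using assms by auto
  moreover have "(of_int a :: rat) = of_int b * of_int d + of_nat p * of_int t"
    using arg_cong[OF t, of "of_int :: int \<Rightarrow> rat"] by (simp add: algebra_simps)
  ultimately have "(of_int a / of_int d - of_int b) / of_nat p = (of_int t / of_int d :: rat)"
    by (simp add: field_simps)
  then show ?thesis
    unfolding rat_cong_def using assms by (simp add: p_integral_of_int_divide p_integral_of_int)
qed

lemma rat_cong_sum:
  assumes "prime p" "\<And>i. i \<in> A \<Longrightarrow> [f i \<equiv> g i] (pmod p)"
  shows "[(\<Sum>i\<in>A. f i) \<equiv> (\<Sum>i\<in>A. g i)] (pmod p)"
proof -
  have "((\<Sum>i\<in>A. f i) - (\<Sum>i\<in>A. g i)) / of_nat p = (\<Sum>i\<in>A. (f i - g i) / of_nat p)"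
    by (simp only: sum_subtractf [symmetric] sum_divide_distrib)
  then show ?thesis
    using assms unfolding rat_cong_def by (auto intro!: p_integral_sum)
qed

lemma rat_cong_sym:
  assumes "prime p" "[x \<equiv> y] (pmod p)"
  shows "[y \<equiv> x] (pmod p)"
proof -
  obtain a d where "\<not> int p dvd d" "(x - y) / of_nat p = of_int a / of_int d"
    using assms by (auto simp: rat_cong_def p_integral_iff)
  moreover from this(2) have "(y - x) / of_nat p = of_int (- a) / of_int d"
    by (metis minus_diff_eq minus_divide_left of_int_minus)
  ultimately show ?thesis
    using assms unfolding rat_cong_def by (metis p_integral_of_int_divide)
qed

lemma rat_cong_trans:
  assumes "prime p" "[x \<equiv> y] (pmod p)" "[y \<equiv> z] (pmod p)"
  shows "[x \<equiv> z] (pmod p)"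
proof -
  have "(x - z) / of_nat p = (x - y) / of_nat p + (y - z) / of_nat p"
    by (simp add: diff_divide_distrib)
  then show ?thesis using assms unfolding rat_cong_def by (simp add: p_integral_add)
qed

section \<open>Binomial coefficients modulo a prime\<close>

lemma central_binomial_Suc:
  "Suc n * ((2 * Suc n) choose Suc n) = 2 * (2 * n + 1) * ((2 * n) choose n)"
proof -
  have "Suc n * ((2 * Suc n) choose Suc n) = 2 * Suc n * (Suc (2 * n) choose n)"
    using Suc_times_binomial_eq[of "Suc (2 * n)" n] by simp
  also have "Suc (2 * n) choose n = Suc (2 * n) choose Suc n"
    using binomial_symmetric[of n "Suc (2 * n)"] by simp
  also have "2 * Suc n * (Suc (2 * n) choose Suc n) = 2 * (Suc (2 * n) * (2 * n choose n))"
    using Suc_times_binomial_eq[of "2 * n" n] by simp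
  finally show ?thesis by simp
qed

text \<open>Passing from \<open>n\<close> to \<open>n + 1\<close> multiplies the left side by 2(2n +
  1)/(n + 1) and the right side by -4(m - n)/(n + 1). These factors agree modulo \<open>p\<close>
  because 2m is congruent to -1.\<close>

lemma central_binomial_cong:
  assumes "prime p" "p = 2 * m + 1" "n \<le> m"
  shows "[int ((2 * n) choose n) = int (m choose n) * (- 4) ^ n] (mod int p)"
  using assms(3)
proof (induction n)
  case 0
  then show ?case by simp
next
  case (Suc n)
  have IH: "[int ((2 * n) choose n) = int (m choose n) * (- 4) ^ n] (mod int p)"
    using Suc by simp
  have step: "int (Suc n) * int (m choose Suc n) = (int m - int n) * int (m choose n)"
  proof -
    have "Suc n * (m choose Suc n) = (m - n) * (m choose n)"
      using binomial_absorb_comp[of m n] binomial_absorption[of n m]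
      by simp
    then show ?thesis using Suc.prems
      by (metis Suc_leD of_nat_diff of_nat_mult)
  qed
  have "int (Suc n) * int ((2 * Suc n) choose Suc n) = 2 * (2 * int n + 1) * int ((2 * n) choose n)"
    using arg_cong[OF central_binomial_Suc[of n], of int] by (simp add: algebra_simps)
  also have "[\<dots> = 2 * (2 * int n + 1) * (int (m choose n) * (- 4) ^ n)] (mod int p)"
    using IH by (rule cong_scalar_left)
  also have "[2 * (2 * int n + 1) * (int (m choose n) * (- 4) ^ n)
      = (- 4) * (int m - int n) * (int (m choose n) * (- 4) ^ n)] (mod int p)"
  proof (rule cong_scalar_right)
    have "2 * (2 * int n + 1) - (- 4) * (int m - int n) = int p * 2"
      using assms(2) by simp
    then show "[2 * (2 * int n + 1) = (- 4) * (int m - int n)] (mod int p)"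
      by (metis cong_iff_dvd_diff dvd_triv_left)
  qed
  also have "(- 4) * (int m - int n) * (int (m choose n) * (- 4) ^ n)
      = int (Suc n) * (int (m choose Suc n) * (- 4) ^ Suc n)"
    using step by (simp add: mult.assoc [symmetric]) (simp add: algebra_simps)
  finally have "[int (Suc n) * int ((2 * Suc n) choose Suc n)
      = int (Suc n) * (int (m choose Suc n) * (- 4) ^ Suc n)] (mod int p)" .
  \<comment> \<open>Since n + 1 <= m < p, the factor n + 1 can be cancelled.\<close>
  moreover have "coprime (int (Suc n)) (int p)"
  proof -
    have "\<not> p dvd Suc n" using Suc.prems assms(2) by (auto dest: dvd_imp_le)
    then show ?thesis
      using assms(1) by (metis coprime_commute coprime_int_iff prime_imp_coprime)
  qed
  ultimately show ?case by (simp only: cong_mult_lcancel)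
qed

section \<open>Gauss's lemma for 2\<close>

lemma two_power_cong:
  assumes "prime p" "p = 2 * m + 1"
  shows "[2 ^ m = (- 1) ^ ((m + 1) div 2)] (mod int p)"
proof -
  \<comment> \<open>The residue of 2j nearest to 0 is \<open>s j * h j\<close>, with sign
    \<open>s j\<close> and absolute value \<open>h j\<close>.\<close>
  define h where "h j = (if 2 * j \<le> m then 2 * j else p - 2 * j)" for j
  define s :: "nat \<Rightarrow> int" where "s j = (if 2 * j \<le> m then 1 else - 1)" for j
  \<comment> \<open>A collision between the two branches would give 2i = p - 2j, which is impossible
    for odd \<open>p\<close>.\<close>
  have "inj_on h {1..m}"
    unfolding inj_on_def h_def using assms(2) by (auto split: if_splits) presburger+
  moreover have "h ` {1..m} \<subseteq> {1..m}"
    unfolding h_def using assms(2) by auto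
  ultimately have bij: "bij_betw h {1..m} {1..m}"
    by (simp add: bij_betw_def endo_inj_surj)
  \<comment> \<open>The sign is negative exactly for j > m div 2, that is, for (m + 1) div 2
    indices.\<close>
  have "(\<Prod>j=1..m. s j) = (\<Prod>j=1..m div 2. s j) * (\<Prod>j=m div 2 + 1..m. s j)"
    using prod.ub_add_nat[of 1 "m div 2" s "m - m div 2"] by simp
  also have "(\<Prod>j=1..m div 2. s j) = 1"
    unfolding s_def by (intro prod.neutral) auto
  also have "(\<Prod>j=m div 2 + 1..m. s j) = (\<Prod>j=m div 2 + 1..m. - 1)"
    unfolding s_def by (intro prod.cong) auto
  also have "\<dots> = (- 1) ^ ((m + 1) div 2)"
  proof -
    have "m - m div 2 = (m + 1) div 2" by presburger
    then show ?thesis by simp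
  qed
  finally have s: "(\<Prod>j=1..m. s j) = (- 1) ^ ((m + 1) div 2)" by simp
  have "2 ^ m * fact m = (\<Prod>j=1..m. 2 * int j)"
    by (simp add: fact_prod prod.distrib)
  also have "[\<dots> = (\<Prod>j=1..m. s j * int (h j))] (mod int p)"
  proof (rule cong_prod)
    fix j assume "j \<in> {1..m}"
    then show "[2 * int j = s j * int (h j)] (mod int p)"
      unfolding s_def h_def using assms(2) by (auto simp: cong_iff_dvd_diff of_nat_diff)
  qed
  also have "(\<Prod>j=1..m. s j * int (h j)) = (- 1) ^ ((m + 1) div 2) * (\<Prod>j=1..m. int (h j))"
    by (simp only: prod.distrib s)
  also have "(\<Prod>j=1..m. int (h j)) = fact m"
    using prod.reindex_bij_betw[OF bij, of int] by (simp add: fact_prod)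
  finally have "[2 ^ m * fact m = (- 1) ^ ((m + 1) div 2) * fact m] (mod int p)" .
  moreover have "coprime (fact m) (int p)"
  proof -
    have "\<not> p dvd fact m" using assms by (simp add: prime_dvd_fact_iff)
    then have "coprime (fact m) p"
      using assms(1) by (metis coprime_commute prime_imp_coprime)
    then show ?thesis by (metis coprime_int_iff of_nat_fact)
  qed
  ultimately show ?thesis by (simp only: cong_mult_rcancel)
qed

section \<open>Trisection of the binomial sum\<close>

text \<open>\<open>hex n\<close> is \<open>2 cos(\<pi> n / 3)\<close>.\<close>

fun hex :: "nat \<Rightarrow> int" where
  "hex 0 = 2"
| "hex (Suc 0) = 1"
| "hex (Suc (Suc n)) = hex (Suc n) - hex n"

lemma hex_add_3: "hex (n + 3) = - hex n"
  by (simp add: numeral_3_eq_3)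

lemma hex_add_mult_3: "hex (3 * q + n) = (- 1) ^ q * hex n"
proof (induction q)
  case (Suc q)
  have "3 * Suc q + n = (3 * q + n) + 3" by simp
  then show ?case using Suc by (simp only: hex_add_3) simp
qed simp

text \<open>This makes \<open>1 + hex (2 * k)\<close> three times the indicator of the multiples of
  3, the filter used for trisection.\<close>

lemma hex_double: "hex (2 * k) = (if 3 dvd k then 2 else - 1)"
proof -
  have "2 * k = 3 * (2 * (k div 3)) + 2 * (k mod 3)" by presburger
  then have "hex (2 * k) = hex (2 * (k mod 3))"
    by (metis hex_add_mult_3 mult_1 power_minus1_even)
  moreover have hex_values: "hex 2 = - 1" "hex 4 = - 1"
    by (simp_all add: eval_nat_numeral)
  moreover consider "k mod 3 = 0" | "k mod 3 = 1" | "k mod 3 = 2" by linarith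
  then have "hex (2 * (k mod 3)) = (if 3 dvd k then 2 else - 1)"
    using hex_values by cases (simp_all add: dvd_eq_mod_eq_0)
  ultimately show ?thesis by simp
qed

text \<open>Pascal's rule, with the shift moved from the binomial coefficients to an arbitrary
  weight \<open>f\<close>.\<close>

lemma sum_binomial_Suc:
  fixes f :: "nat \<Rightarrow> int"
  shows "(\<Sum>k\<le>Suc m. int (Suc m choose k) * f k) = (\<Sum>k\<le>m. int (m choose k) * (f k + f (Suc k)))"
proof -
  have "(\<Sum>k\<le>Suc m. int (Suc m choose k) * f k)
      = (\<Sum>k\<le>m. int (m choose k) * f (Suc k)) + (f 0 + (\<Sum>k\<le>m. int (m choose Suc k) * f (Suc k)))"
    by (simp only: sum.atMost_Suc_shift) (simp add: algebra_simps sum.distrib)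
  \<comment> \<open>The added top term on the right vanishes, as \<open>m choose Suc m\<close> is
    0.\<close>
  also have "f 0 + (\<Sum>k\<le>m. int (m choose Suc k) * f (Suc k)) = (\<Sum>k\<le>Suc m. int (m choose k) * f k)"
    by (simp only: sum.atMost_Suc_shift) simp
  finally show ?thesis by (simp add: algebra_simps sum.distrib)
qed

text \<open>The sum is the real part of \<open>2 \<zeta>^r (1 + \<zeta>^2)^m\<close> for \<open>\<zeta> = exp(i \<pi> / 3)\<close>, and \<open>1 + \<zeta>^2 = \<zeta>\<close>.\<close>

lemma sum_binomial_hex: "(\<Sum>k\<le>m. int (m choose k) * hex (2 * k + r)) = hex (m + r)"
proof (induction m arbitrary: r)
  case (Suc m)
  \<comment> \<open>The recurrence of \<open>hex\<close> merges both weights into one with offset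
    \<open>r + 1\<close>, hence the induction for arbitrary \<open>r\<close>.\<close>
  have "hex (2 * k + r) + hex (2 * Suc k + r) = hex (2 * k + Suc r)" for k
    by simp
  then show ?case
    using Suc[of "Suc r"] by (simp only: sum_binomial_Suc) simp
qed simp

lemma sum_binomial_multiples_of_3: "3 * (\<Sum>k=0..m div 3. int (m choose (3 * k))) = 2 ^ m + hex m"
proof -
  have "(\<Sum>k=0..m div 3. int (m choose (3 * k))) = (\<Sum>j\<in>{j. j \<le> m \<and> 3 dvd j}. int (m choose j))"
    by (rule sum.reindex_bij_witness[of _ "\<lambda>j. j div 3" "\<lambda>k. 3 * k"]) auto
  also have "\<dots> = (\<Sum>j\<le>m. if 3 dvd j then int (m choose j) else 0)"
    by (simp add: sum.If_cases Collect_conj_eq atMost_def)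
  also have "3 * \<dots> = (\<Sum>j\<le>m. int (m choose j) + int (m choose j) * hex (2 * j + 0))"
    unfolding sum_distrib_left by (intro sum.cong) (simp_all add: hex_double)
  also have "\<dots> = int (\<Sum>j\<le>m. m choose j) + hex m"
    by (simp only: sum.distrib sum_binomial_hex) simp
  finally show ?thesis by (simp add: choose_row_sum)
qed

section \<open>The congruence\<close>

text \<open>Both cases of the theorem at once: only the value of \<open>hex m\<close> depends on
  \<open>p\<close> modulo 3.\<close>

lemma sum_binomial_6k_3k_rat_cong:
  assumes "prime p" "p > 3" "p = 2 * m + 1"
  shows "[(\<Sum>k = 0..(p - 1) div 6. of_nat ((6 * k) choose (3 * k)) / (- 64) ^ k)
    \<equiv> of_int ((- 1) ^ ((p + 1) div 4) + hex m) / 3] (pmod p)"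
proof -
  have unit: "\<not> int p dvd (- 64) ^ k" for k
  proof
    assume "int p dvd (- 64) ^ k"
    then have "int p dvd - 64" using assms(1) by (meson prime_dvd_power prime_nat_int_transfer)
    then have "int p dvd 2 ^ 6" by simp
    then have "int p dvd 2" using assms(1) by (meson prime_dvd_power prime_nat_int_transfer)
    then show False using assms(2) by (auto dest: zdvd_imp_le)
  qed
  have unit3: "\<not> int p dvd 3" using assms(2) by (auto dest: zdvd_imp_le)
  have ends: "(p - 1) div 6 = m div 3" "(p + 1) div 4 = (m + 1) div 2"
    using assms(3) by presburger+
  have "[of_nat ((6 * k) choose (3 * k)) / (- 64) ^ k \<equiv> of_int (int (m choose (3 * k)))] (pmod p)"
    if "k \<in> {0..m div 3}" for k
  proof -
    \<comment> \<open>Here (-4)^(3k) = (-64)^k, and k <= m div 3 ensures 3k <= m.\<close>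
    have "[int ((6 * k) choose (3 * k)) = int (m choose (3 * k)) * (- 64) ^ k] (mod int p)"
      using central_binomial_cong[OF assms(1,3), of "3 * k"] that by (simp add: power_mult)
    from rat_cong_of_int_divide[OF assms(1) unit this] show ?thesis by simp
  qed
  then have "[(\<Sum>k = 0..m div 3. of_nat ((6 * k) choose (3 * k)) / (- 64) ^ k)
      \<equiv> (\<Sum>k = 0..m div 3. of_int (int (m choose (3 * k))))] (pmod p)"
    by (rule rat_cong_sum[OF assms(1)])
  then have "[(\<Sum>k = 0..m div 3. of_nat ((6 * k) choose (3 * k)) / (- 64) ^ k)
      \<equiv> of_int (\<Sum>k = 0..m div 3. int (m choose (3 * k)))] (pmod p)"
    by (simp only: of_int_sum)
  moreover
  have "[(- 1) ^ ((m + 1) div 2) + hex m = 2 ^ m + hex m] (mod int p)"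
    using two_power_cong[OF assms(1,3)] by (intro cong_add cong_refl) (rule cong_sym)
  then have "[(- 1) ^ ((m + 1) div 2) + hex m
      = (\<Sum>k=0..m div 3. int (m choose (3 * k))) * 3] (mod int p)"
    by (simp only: sum_binomial_multiples_of_3[symmetric] mult.commute)
  \<comment> \<open>Division by 3 is allowed since p > 3. Both sides of the claim are now congruent
    to the same integer.\<close>
  from rat_cong_of_int_divide[OF assms(1) unit3 this]
  have "[of_int ((- 1) ^ ((m + 1) div 2) + hex m) / 3
      \<equiv> of_int (\<Sum>k = 0..m div 3. int (m choose (3 * k)))] (pmod p)"
    by (simp only: of_int_numeral)
  ultimately show ?thesis
    unfolding ends using rat_cong_trans[OF assms(1)] rat_cong_sym[OF assms(1)] by blast
qed

theorem theorem4p1: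
  fixes p :: nat
  assumes "prime p" and "p > 3"
  shows "(3 dvd p - 1 \<longrightarrow>
           [(\<Sum>k = 0..(p - 1) div 6. of_nat ((6 * k) choose (3 * k)) / (- 64) ^ k) \<equiv>
            1 / 3 * ((- 1) ^ ((p + 1) div 4) + 2 * (- 1) ^ ((p - 1) div 2))] (pmod p)) \<and>
         (3 dvd p - 2 \<longrightarrow>
           [(\<Sum>k = 0..(p - 1) div 6. of_nat ((6 * k) choose (3 * k)) / (- 64) ^ k) \<equiv>
            1 / 3 * ((- 1) ^ ((p + 1) div 4) - (- 1) ^ ((p - 1) div 2))] (pmod p))"
proof -
  define m where "m = (p - 1) div 2"
  have "odd p" using assms prime_odd_nat by simp
  then have p: "p = 2 * m + 1" unfolding m_def by presburger
  note main = sum_binomial_6k_3k_rat_cong[OF assms p]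
  show ?thesis
  proof (intro conjI impI)
    assume "3 dvd p - 1"
    then have "3 dvd m" using p by presburger
    then obtain q where q: "m = 3 * q" by (rule dvdE)
    \<comment> \<open>\<open>q\<close> and 3q have the same parity, so (-1)^q = (-1)^m.\<close>
    have "hex m = 2 * (- 1) ^ m"
      using hex_add_mult_3[of q 0] by (simp add: q power_mult)
    then show "[(\<Sum>k = 0..(p - 1) div 6. of_nat ((6 * k) choose (3 * k)) / (- 64) ^ k) \<equiv>
            1 / 3 * ((- 1) ^ ((p + 1) div 4) + 2 * (- 1) ^ ((p - 1) div 2))] (pmod p)"
      using main unfolding m_def[symmetric] by simp
  next
    assume "3 dvd p - 2"
    \<comment> \<open>As p - 2 = 2m - 1, divisibility by 3 forces \<open>m\<close> to be 2 modulo 3;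
      again \<open>q\<close> and \<open>m\<close> have the same parity.\<close>
    then have "\<exists>q. m = 3 * q + 2" using p assms(2) by presburger
    then obtain q where q: "m = 3 * q + 2" ..
    have "hex 2 = - 1" by (simp add: numeral_2_eq_2)
    then have "hex m = - ((- 1) ^ m)"
      using hex_add_mult_3[of q 2] by (simp add: q power_mult power_add)
    then show "[(\<Sum>k = 0..(p - 1) div 6. of_nat ((6 * k) choose (3 * k)) / (- 64) ^ k) \<equiv>
            1 / 3 * ((- 1) ^ ((p + 1) div 4) - (- 1) ^ ((p - 1) div 2))] (pmod p)"
      using main unfolding m_def[symmetric] by simp
  qed
qed

end
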